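(* Assume that $(\overline{\widehat{K}}(X)|K,v)$ is an extension of valued fields, where $\widehat{K}$ is the completion of $(K,v)$, such that $(\widehat{K}(X)|\widehat{K},v)$ is valuation algebraic. Then $(\widehat{K}(X)|\widehat{K},v)$ is induced by the valuation algebraic extension $(K(X)|K,v)$ (in particular, $(K(X)|K,v)$ is valuation algebraic). Moreover, the extension $(\widehat{K}(X)|K(X),v)$ is immediate.
   Context: Valuations are Krull valuations written additively; $vL$, $Lv$ denote value group and residue field. An extension is immediate if value groups and residue fields coincide. $(K,v)$ is dense in $(L,v)$ if for every $a\in L$, $\gamma\in vL$ there is $b\in K$ with $v(a-b)>\gamma$; the completion $(\widehat{K},v)$ is the maximal extension in which $(K,v)$ is dense. "An extension of valued fields $(\overline{\widehat{K}}(X)|K,v)$" means a valuation $v$ on $\overline{\widehat{K}}(X)$ ($\overline{\widehat{K}}\supseteq\overline{K}$ the algebraic closure of $\widehat{K}$) whose restriction to $\widehat{K}$ is the valuation of the completion; all subfields carry the restricted valuation. $(F(X)|F,v)$ is valuation algebraic if $vF(X)/vF$ is a torsion group and $F(X)v|Fv$ is algebraic. A sequence $\{z_\nu\}_{\nu<\lambda}$ ($\lambda$ a limit ordinal) is a pseudo-Cauchy sequence (pCs) if $v(z_{\nu_1}-z_{\nu_2})<v(z_{\nu_2}-z_{\nu_3})$ for $\nu_1<\nu_2<\nu_3$; $y$ is a limit if $v(y-z_\nu)=v(z_\nu-z_{\nu+1})$ for all $\nu$. For $b\in\overline{\widehat{K}}$ and $\beta$ in an ordered abelian group containing $v\overline{\widehat{K}}$,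 $v_{b,\beta}$ is the valuation on $\overline{\widehat{K}}(X)$ with $v_{b,\beta}\big(\sum C_i(X-b)^i\big)=\min_i\{vC_i+i\beta\}$. When $(K(X)|K,v)$ is valuation algebraic, "$(\widehat{K}(X)|\widehat{K},v)$ is induced by $(K(X)|K,v)$" means that $v|_{\widehat{K}(X)}$ is, up to equivalence of valuations, the restriction of the following valuation on $\overline{\widehat{K}}(X)$ constructed from $v|_{\overline{\widehat{K}}}$ and $v|_{\overline{K}(X)}$ (independent of choices): take a strictly increasing cofinal sequence $\{\gamma_\nu\}_{\nu<\lambda}$ in $\{v(X-c)\mid c\in\overline{K}\}$ and $a_\nu\in\overline{K}$ with $v(X-a_\nu)=\gamma_\nu$; if the pCs $\{a_\nu\}$ has a limit $b\in\overline{\widehat{K}}$, the valuation is $v_{b,\beta}$ with $\beta=(1,0)\in(\mathbb{Z}\oplus v\overline{K})_{\mathrm{lex}}$ (with $v\overline{K}$ embedded by $\alpha\mapsto(0,\alpha)$); otherwise it is the unique extension of $v|_{\overline{\widehat{K}}}$ to $\overline{\widehat{K}}(X)$ for which $X$ is a limit of $\{a_\nu\}$. *)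

theory Defs
  imports
    "HOL-Algebra.Algebraic_Closure_Type"
    "HOL-Library.Extended"
    "HOL-Library.Product_Plus"
    "HOL-Library.Product_Lexorder"
begin

section \<open>Valued fields\<close>

text \<open>Valuations are written additively and take values in \<open>'g \<union> {\<infinity>}\<close>, where
  \<open>'g\<close> is an ordered abelian group.  The type \<^typ>\<open>'g extended\<close> also has a least element
  \<open>-\<infinity>\<close>, which is excluded as a value.\<close>

locale valued_field = field R for R (structure) +
  fixes v :: "'a \<Rightarrow> 'g::linordered_ab_group_add extended"
  assumes val_not_Minf: "x \<in> carrier R \<Longrightarrow> v x \<noteq> -\<infinity>"
    and val_eq_Pinf_iff: "x \<in> carrier R \<Longrightarrow> v x = \<infinity> \<longleftrightarrow> x = \<zero>"
    and val_mult: "x \<in> carrier R \<Longrightarrow> y \<in> carrier R \<Longrightarrow> v (x \<otimes> y) = v x + v y"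
    and val_add: "x \<in> carrier R \<Longrightarrow> y \<in> carrier R \<Longrightarrow> min (v x) (v y) \<le> v (x \<oplus> y)"

definition value_group :: "('a \<Rightarrow> 'g extended) \<Rightarrow> 'a set \<Rightarrow> 'g set"
  where "value_group v L = {\<gamma>. \<exists>x\<in>L. v x = Fin \<gamma>}"

definition valuation_ring ::
    "('a, 'm) ring_scheme \<Rightarrow> ('a \<Rightarrow> 'g::linordered_ab_group_add extended) \<Rightarrow> ('a, 'm) ring_scheme"
  where "valuation_ring R v = R\<lparr>carrier := {x \<in> carrier R. 0 \<le> v x}\<rparr>"

definition valuation_ideal ::
    "('a, 'm) ring_scheme \<Rightarrow> ('a \<Rightarrow> 'g::linordered_ab_group_add extended) \<Rightarrow> 'a set"
  where "valuation_ideal R v = {x \<in> carrier R. 0 < v x}"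

definition residue_field ::
    "('a, 'm) ring_scheme \<Rightarrow> ('a \<Rightarrow> 'g::linordered_ab_group_add extended) \<Rightarrow> 'a set ring"
  where "residue_field R v = valuation_ring R v Quot valuation_ideal R v"

text \<open>The residue field of a subfield \<open>L\<close> of \<open>R\<close>, as a subfield of the residue field of \<open>R\<close>;
  thus inclusions of subfields induce inclusions of their residue fields.\<close>

definition residue_subfield ::
    "('a, 'm) ring_scheme \<Rightarrow> ('a \<Rightarrow> 'g::linordered_ab_group_add extended) \<Rightarrow> 'a set \<Rightarrow> 'a set set"
  where "residue_subfield R v L =
    (\<lambda>x. valuation_ideal R v +>\<^bsub>valuation_ring R v\<^esub> x) ` {x \<in> L. 0 \<le> v x}"

text \<open>In the following, \<open>F \<subseteq> L\<close> are subfields of \<open>R\<close> carrying the restrictions of \<open>v\<close>.\<close>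

definition immediate ::
    "('a, 'm) ring_scheme \<Rightarrow> ('a \<Rightarrow> 'g::linordered_ab_group_add extended) \<Rightarrow> 'a set \<Rightarrow> 'a set \<Rightarrow> bool"
  where "immediate R v F L \<longleftrightarrow>
    value_group v F = value_group v L \<and> residue_subfield R v F = residue_subfield R v L"

text \<open>The first conjunct says that \<open>vL/vF\<close> is a torsion group; the sum is \<open>n\<gamma>\<close>.\<close>

definition valuation_algebraic ::
    "('a, 'm) ring_scheme \<Rightarrow> ('a \<Rightarrow> 'g::linordered_ab_group_add extended) \<Rightarrow> 'a set \<Rightarrow> 'a set \<Rightarrow> bool"
  where "valuation_algebraic R v F L \<longleftrightarrow>
    (\<forall>\<gamma>\<in>value_group v L. \<exists>n>0. (\<Sum>_<(n::nat). \<gamma>) \<in> value_group v F) \<and>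
    (\<forall>\<xi>\<in>residue_subfield R v L. (ring.algebraic (residue_field R v) over residue_subfield R v F) \<xi>)"

definition dense_in ::
    "('a, 'm) ring_scheme \<Rightarrow> ('a \<Rightarrow> 'g::linordered_ab_group_add extended) \<Rightarrow> 'a set \<Rightarrow> 'a set \<Rightarrow> bool"
  where "dense_in R v F L \<longleftrightarrow>
    (\<forall>a\<in>L. \<forall>\<gamma>\<in>value_group v L. \<exists>b\<in>F. Fin \<gamma> < v (a \<ominus>\<^bsub>R\<^esub> b))"

text \<open>\<open>Kc\<close> is the completion of \<open>K\<close>: \<open>K\<close> is dense in \<open>Kc\<close>, and every valued field extension
  \<open>h : Kc \<rightarrow> L\<close> in which \<open>K\<close> is still dense is trivial.

  The extension fields \<open>L\<close> range over fields with carrier in the type \<open>'a\<close> and with values in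
  \<open>'g\<close>.  This is no restriction.  Values: if \<open>K\<close> is dense in \<open>L\<close>, then \<open>vL = vK\<close>.  Carrier: if
  \<open>L\<close> is a proper extension and \<open>x \<in> L - Kc\<close>, then \<open>Kc(x)\<close> is a proper extension in which
  \<open>K\<close> is dense; here \<open>Kc\<close> is infinite (valuations of finite fields are trivial, and a
  trivially valued field is dense only in itself), so \<open>Kc(x)\<close> has the cardinality of \<open>Kc\<close>.\<close>

definition is_completion ::
    "'a ring \<Rightarrow> ('a \<Rightarrow> 'g::linordered_ab_group_add extended) \<Rightarrow> 'a set \<Rightarrow> 'a set \<Rightarrow> bool"
  where "is_completion R v K Kc \<longleftrightarrow>
    subfield K R \<and> subfield Kc R \<and> K \<subseteq> Kc \<and> dense_in R v K Kc \<and>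
    (\<forall>(L :: 'a ring) (w :: 'a \<Rightarrow> 'g extended) h.
       valued_field L w \<and> h \<in> ring_hom (R\<lparr>carrier := Kc\<rparr>) L \<and> (\<forall>x\<in>Kc. w (h x) = v x) \<and>
       dense_in L w (h ` K) (carrier L)
       \<longrightarrow> h ` Kc = carrier L)"

text \<open>Two valuations are equivalent on \<open>L\<close> if they have the same valuation ring in \<open>L\<close>.\<close>

definition equivalent_on ::
    "'a set \<Rightarrow> ('a \<Rightarrow> 'g::linordered_ab_group_add extended) \<Rightarrow>
     ('a \<Rightarrow> 'h::linordered_ab_group_add extended) \<Rightarrow> bool"
  where "equivalent_on L v w \<longleftrightarrow> {x \<in> L. 0 \<le> v x} = {x \<in> L. 0 \<le> w x}"


section \<open>Pseudo-Cauchy sequences\<close>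

text \<open>A limit ordinal \<open>\<lambda>\<close> is represented by a nonempty well-order without a last element, and a
  sequence of length \<open>\<lambda>\<close> by a function on the field of that well-order.\<close>

definition limit_order :: "'i rel \<Rightarrow> bool"
  where "limit_order r \<longleftrightarrow>
    Well_order r \<and> Field r \<noteq> {} \<and> (\<forall>i\<in>Field r. \<exists>j. (i, j) \<in> r - Id)"

definition pseudo_cauchy ::
    "('a, 'm) ring_scheme \<Rightarrow> ('a \<Rightarrow> 'g::linordered_ab_group_add extended) \<Rightarrow> 'i rel \<Rightarrow> ('i \<Rightarrow> 'a) \<Rightarrow> bool"
  where "pseudo_cauchy R v r z \<longleftrightarrow> limit_order r \<and>
    (\<forall>i j k. (i, j) \<in> r - Id \<and> (j, k) \<in> r - Id \<longrightarrow>
       v (z i \<ominus>\<^bsub>R\<^esub> z j) < v (z j \<ominus>\<^bsub>R\<^esub> z k))"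

definition pseudo_limit ::
    "('a, 'm) ring_scheme \<Rightarrow> ('a \<Rightarrow> 'g::linordered_ab_group_add extended) \<Rightarrow> 'i rel \<Rightarrow> ('i \<Rightarrow> 'a) \<Rightarrow>
     'a \<Rightarrow> bool"
  where "pseudo_limit R v r z y \<longleftrightarrow> pseudo_cauchy R v r z \<and>
    (\<forall>i\<in>Field r. v (y \<ominus>\<^bsub>R\<^esub> z i) = v (z i \<ominus>\<^bsub>R\<^esub> z (wo_rel.suc r {i})))"


section \<open>Rational function fields\<close>

text \<open>For a field \<open>C\<close> given by the type \<open>'a\<close>, the field \<open>C(X)\<close> is the type \<^typ>\<open>'a poly fract\<close>.\<close>

abbreviation ratfun_field :: "'a::field poly fract ring"
  where "ratfun_field \<equiv> ring_of_type_algebra"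

definition const_fract :: "'a::field \<Rightarrow> 'a poly fract"
  where "const_fract c = to_fract [:c:]"

definition X_fract :: "'a::field poly fract"
  where "X_fract = to_fract [:0, 1:]"

text \<open>The subfield \<open>F(X)\<close> of \<open>C(X)\<close>, for a subfield \<open>F\<close> of \<open>C\<close>.\<close>

definition ratfuns :: "'a::field set \<Rightarrow> 'a poly fract set"
  where "ratfuns F = {Fract p q | p q. q \<noteq> 0 \<and> range (Polynomial.coeff p) \<subseteq> F \<and> range (Polynomial.coeff q) \<subseteq> F}"

definition relative_alg_closure :: "'a::field set \<Rightarrow> 'a set"
  where "relative_alg_closure K = {c. (ring.algebraic (ring_of_type_algebra :: 'a ring) over K) c}"

text \<open>\<open>w\<close> is the valuation \<open>v\<^sub>b\<^sub>,\<^sub>\<beta>\<close> on \<open>C(X)\<close> built from the valuation \<open>u\<close> on \<open>C\<close>; the map \<open>\<iota>\<close>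
  embeds the value group of \<open>u\<close> into the group containing \<open>\<beta>\<close>.  If \<open>p = \<Sum> C\<^sub>i Y\<^sup>i\<close>, then
  \<open>p \<circ>\<^sub>p [:- b, 1:]\<close> is \<open>\<Sum> C\<^sub>i (X - b)\<^sup>i\<close>.  The values on polynomials determine \<open>w\<close>.\<close>

definition is_v_b_beta ::
    "('a::field \<Rightarrow> 'g::linordered_ab_group_add extended) \<Rightarrow> ('g \<Rightarrow> 'h::linordered_ab_group_add) \<Rightarrow>
     'a \<Rightarrow> 'h \<Rightarrow> ('a poly fract \<Rightarrow> 'h extended) \<Rightarrow> bool"
  where "is_v_b_beta u \<iota> b \<beta> w \<longleftrightarrow> valued_field ratfun_field w \<and>
    (\<forall>p. w (to_fract (p \<circ>\<^sub>p [:- b, 1:])) =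
      (MIN i\<in>{..Polynomial.degree p}. map_extended \<iota> (u (Polynomial.coeff p i)) + Fin (\<Sum>_<i. \<beta>)))"

text \<open>With the lexicographic order of \<^theory>\<open>HOL-Library.Product_Lexorder\<close>,
  \<open>int \<times> 'g\<close> is the ordered group \<open>(\<int> \<oplus> 'g)\<close> with the lexicographic order.\<close>

instance prod :: (linordered_ab_group_add, linordered_ab_group_add) linordered_ab_group_add
  by standard (auto simp: less_eq_prod_def)


section \<open>Induced valuations\<close>

text \<open>\<open>a\<close> is a sequence in the algebraic closure of \<open>K\<close> such that the values \<open>v(X - a\<^sub>\<nu>)\<close> form a
  strictly increasing cofinal sequence in \<open>{v(X - c)}\<close>, \<open>c\<close> algebraic over \<open>K\<close>.  The
  indices may be taken in \<open>'g\<close>, because \<open>\<nu> \<mapsto> v(X - a\<^sub>\<nu>)\<close> is injective with finite values.\<close>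

definition cofinal_approx ::
    "('a::field poly fract \<Rightarrow> 'g::linordered_ab_group_add extended) \<Rightarrow> 'a set \<Rightarrow> 'g rel \<Rightarrow> ('g \<Rightarrow> 'a) \<Rightarrow> bool"
  where "cofinal_approx v K r a \<longleftrightarrow> limit_order r \<and>
    (\<forall>i\<in>Field r. a i \<in> relative_alg_closure K) \<and>
    (\<forall>i j. (i, j) \<in> r - Id \<longrightarrow> v (X_fract - const_fract (a i)) < v (X_fract - const_fract (a j))) \<and>
    (\<forall>c\<in>relative_alg_closure K. \<exists>i\<in>Field r.
       v (X_fract - const_fract c) \<le> v (X_fract - const_fract (a i)))"

definition extends_with_limit ::
    "('a::field poly fract \<Rightarrow> 'g::linordered_ab_group_add extended) \<Rightarrow> 'g rel \<Rightarrow> ('g \<Rightarrow> 'a) \<Rightarrow>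
     ('a poly fract \<Rightarrow> 'g extended) \<Rightarrow> bool"
  where "extends_with_limit v r a w \<longleftrightarrow> valued_field ratfun_field w \<and>
    (\<forall>c. w (const_fract c) = v (const_fract c)) \<and>
    pseudo_limit ratfun_field w r (const_fract \<circ> a) X_fract"

text \<open>The restriction of \<open>v\<close> to \<open>Kc(X)\<close> is induced by the restriction of \<open>v\<close> to \<open>K(X)\<close>.  The type
  \<open>'a\<close> is the algebraic closure of \<open>Kc\<close>, and \<open>K(X)|K\<close> is meant to be valuation algebraic.  The
  construction does not depend on the choice of the approximating sequence and of its
  limit \<open>b\<close>; the definition therefore asks for the stated equivalence for every choice, and
  also that there is a choice.  In the second case the extension is immediate over the algebraically
  closed field \<open>'a\<close>, so it has values in \<open>'g\<close>.\<close>

definition induced_by ::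
    "('a::field poly fract \<Rightarrow> 'g::linordered_ab_group_add extended) \<Rightarrow> 'a set \<Rightarrow> 'a set \<Rightarrow> bool"
  where "induced_by v K Kc \<longleftrightarrow>
    (\<exists>r a. cofinal_approx v K r a) \<and>
    (\<forall>r a. cofinal_approx v K r a \<longrightarrow>
      (if \<exists>b. pseudo_limit ratfun_field v r (const_fract \<circ> a) (const_fract b)
       then \<forall>b. pseudo_limit ratfun_field v r (const_fract \<circ> a) (const_fract b) \<longrightarrow>
         (\<exists>w. is_v_b_beta (v \<circ> const_fract) (\<lambda>\<alpha>. (0::int, \<alpha>)) b (1, 0) w \<and>
              equivalent_on (ratfuns Kc) v w)
       else \<exists>w. extends_with_limit v r a w \<and> (\<forall>w'. extends_with_limit v r a w' \<longrightarrow> w' = w) \<and>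
              equivalent_on (ratfuns Kc) v w))"

end

theory Submission
  imports Defs
begin

text \<open>
  Write \<open>C\<close> for the algebraic closure of \<open>Kc\<close>.  The values \<open>v(X - c)\<close>, \<open>c \<in> C\<close>, have no
  maximum.  Indeed, if \<open>v(X - c)\<close> were maximal, then \<open>v(X - t) \<le> v(c - t)\<close> for all \<open>t\<close>, and splitting
  into linear factors gives \<open>v(P(X)) \<le> v(P(c))\<close> for all polynomials \<open>P\<close> over \<open>C\<close>.  Let \<open>f\<close> be a
  polynomial over \<open>Kc\<close> with \<open>f(c) = 0\<close>.  Some power \<open>f\<^sup>n\<close> has the value of a constant \<open>k\<close>, and the
  residue of \<open>f\<^sup>n/k\<close> is algebraic, so \<open>v(f\<^sup>n - tk) > v(f\<^sup>n) = v(k)\<close> for some \<open>t \<in> C\<close>; but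
  \<open>P = f\<^sup>n - tk\<close> has \<open>v(P(c)) = v(tk) = v(k)\<close>, a contradiction.

  Continuity of roots makes the algebraic closure of \<open>K\<close> dense in \<open>C\<close>, so the values \<open>v(X - c)\<close> with
  \<open>c\<close> algebraic over \<open>K\<close> are cofinal among all of them.  Therefore an approximating sequence never has a
  limit in \<open>C\<close>: only the second case in the construction of the induced valuation occurs, and there
  \<open>v\<close> itself is the unique solution, since its values on linear polynomials are determined by the
  sequence.  The extension is immediate because \<open>K(X)\<close> approximates \<open>Kc(X)\<close>.
\<close>

section \<open>Valued fields on a type\<close>

lemma type_algebra_simps [simp]:
  "carrier ring_of_type_algebra = UNIV"
  "x \<otimes>\<^bsub>ring_of_type_algebra\<^esub> y = x * y"
  "x \<oplus>\<^bsub>ring_of_type_algebra\<^esub> y = x + y"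
  "\<zero>\<^bsub>ring_of_type_algebra\<^esub> = 0"
  "\<one>\<^bsub>ring_of_type_algebra\<^esub> = 1"
  by (simp_all add: ring_of_type_algebra_def)

lemma type_algebra_a_inv [simp]:
  "\<ominus>\<^bsub>ring_of_type_algebra\<^esub> x = - (x :: 'b::comm_ring_1)"
proof -
  interpret R: ring "ring_of_type_algebra :: 'b ring" by rule
  have "x \<oplus>\<^bsub>ring_of_type_algebra\<^esub> - x = \<zero>\<^bsub>ring_of_type_algebra\<^esub>" by simp
  then show ?thesis
    by (metis R.add.inv_equality R.a_comm UNIV_I type_algebra_simps(1))
qed

lemma type_algebra_minus [simp]:
  "x \<ominus>\<^bsub>ring_of_type_algebra\<^esub> y = x - (y :: 'b::comm_ring_1)"
  by (simp add: a_minus_def)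

lemma type_algebra_pow [simp]:
  "x [^]\<^bsub>ring_of_type_algebra\<^esub> (n::nat) = (x :: 'b::comm_ring_1) ^ n"
proof -
  interpret R: ring "ring_of_type_algebra :: 'b ring" by rule
  show ?thesis by (induction n) (auto simp: mult.commute)
qed

text \<open>HOL-Algebra lists the leading coefficient first, \<open>Poly\<close> the constant term
  first; hence \<open>rev\<close>.\<close>

lemma type_algebra_eval:
  "ring.eval ring_of_type_algebra p x = poly (Poly (rev p)) (x :: 'b::comm_ring_1)"
proof -
  interpret R: ring "ring_of_type_algebra :: 'b ring" by rule
  show ?thesis
    by (induction p) (auto simp: Poly_append poly_monom mult.commute add.commute)
qed

text \<open>\<open>Poly\<close> strips trailing zeros; a nonzero head ensures that nothing is
  stripped from the reversed list.\<close>

lemma lead_coeff_Poly_rev: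
  assumes "ks \<noteq> []" "hd ks \<noteq> 0"
  shows "lead_coeff (Poly (rev ks)) = hd ks"
proof -
  have cf: "coeffs (Poly (rev ks)) = rev ks"
    using assms by (cases ks) (auto simp: coeffs_Poly)
  then have "Poly (rev ks) \<noteq> 0" using assms(1) coeffs_0_eq_Nil by (metis rev_is_Nil_conv)
  then show ?thesis
    using last_coeffs_eq_coeff_degree[of "Poly (rev ks)"] assms(1) cf by (simp add: last_rev)
qed

lemma range_coeff_Poly_rev: "range (coeff (Poly (rev ks))) \<subseteq> insert 0 (set ks)"
proof (rule image_subsetI)
  fix i
  show "coeff (Poly (rev ks)) i \<in> insert 0 (set ks)"
    using nth_mem[of i "rev ks"] by (simp add: nth_default_def)
qed

locale field_valuation =
  fixes v :: "'b::field \<Rightarrow> 'g::linordered_ab_group_add extended"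
  assumes valued: "valued_field ring_of_type_algebra v"
begin

lemma val_not_Minf [simp]: "v x \<noteq> -\<infinity>"
  using valued_field.val_not_Minf[OF valued] by simp

lemma val_eq_Pinf [simp]: "v x = \<infinity> \<longleftrightarrow> x = 0"
  using valued_field.val_eq_Pinf_iff[OF valued, of x] by simp

lemma val_zero [simp]: "v 0 = \<infinity>"
  by simp

lemma val_mult: "v (x * y) = v x + v y"
  using valued_field.val_mult[OF valued, of x y] by simp

lemma val_add: "min (v x) (v y) \<le> v (x + y)"
  using valued_field.val_add[OF valued, of x y] by simp

lemma val_FinE:
  assumes "x \<noteq> 0"
  obtains \<gamma> where "v x = Fin \<gamma>"
  using assms val_not_Minf[of x] val_eq_Pinf[of x] by (cases "v x") auto

lemma val_one [simp]: "v 1 = 0"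
proof -
  obtain \<gamma> where g: "v 1 = Fin \<gamma>" using val_FinE[of 1] by auto
  have "v 1 = v 1 + v 1" using val_mult[of 1 1] by simp
  then have "\<gamma> = \<gamma> + \<gamma>" by (simp add: g)
  then show ?thesis by (simp add: g zero_extended_def)
qed

lemma val_minus [simp]: "v (- x) = v x"
proof (cases "x = 0")
  case False
  \<comment> \<open>As ordered groups are torsion-free, (-1)^2 = 1 forces v(-1) = 0.\<close>
  have "v (-1) + v (-1) = 0" using val_mult[of "-1" "-1"] by simp
  moreover obtain \<gamma> where g: "v (-1) = Fin \<gamma>" using val_FinE[of "-1"] by auto
  ultimately have "\<gamma> + \<gamma> = 0" by (simp add: zero_extended_def)
  then have "\<gamma> = 0" by (simp add: double_zero)
  then show ?thesis using val_mult[of "-1" x] g by (simp add: zero_extended_def[symmetric])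
qed simp

lemma val_minus_commute: "v (x - y) = v (y - x)"
  using val_minus[of "x - y"] by simp

lemma val_add_ge: "t \<le> v x \<Longrightarrow> t \<le> v y \<Longrightarrow> t \<le> v (x + y)"
  using val_add[of x y] by (meson min.boundedI order_trans)

lemma val_add_gt: "t < v x \<Longrightarrow> t < v y \<Longrightarrow> t < v (x + y)"
  using val_add[of x y] by (metis less_le_trans min_less_iff_conj)

lemma val_diff_ge: "t \<le> v x \<Longrightarrow> t \<le> v y \<Longrightarrow> t \<le> v (x - y)"
  using val_add_ge[of t x "- y"] by simp

lemma val_diff_gt: "t < v x \<Longrightarrow> t < v y \<Longrightarrow> t < v (x - y)"
  using val_add_gt[of t x "- y"] by simp

text \<open>If \<open>x - y\<close> had larger value than \<open>x\<close>, then \<open>x\<close>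
  would be a sum of two elements, \<open>x - y\<close> and \<open>y\<close>, of value greater than
  \<open>v x\<close>.\<close>

lemma val_diff_eq_left: "v x < v y \<Longrightarrow> v (x - y) = v x"
  using val_add_gt[of "v x" "x - y" y] val_diff_ge[of "v x" x y]
  by (metis diff_add_cancel less_imp_le order.refl order_less_le)

lemma val_eq_if_diff_gt: "v x < v (x - y) \<Longrightarrow> v y = v x"
  using val_diff_eq_left[of x "x - y"] by simp

lemma val_mult_mono: "v a \<le> v b \<Longrightarrow> v c \<le> v d \<Longrightarrow> v (a * c) \<le> v (b * d)"
  by (simp add: val_mult add_mono)

lemma val_mult_less: "v a < v b \<Longrightarrow> c \<noteq> 0 \<Longrightarrow> v (c * a) < v (c * b)"
  by (cases "v a"; cases "v b"; erule val_FinE) (auto simp: val_mult)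

lemma val_inverse_mono:
  assumes "x \<noteq> 0" "y \<noteq> 0" "v x \<le> v y"
  shows "v (inverse y) \<le> v (inverse x)"
proof -
  have "v (inverse x * inverse y * x) \<le> v (inverse x * inverse y * y)"
    using assms by (intro val_mult_mono) auto
  with assms show ?thesis by (simp add: field_simps)
qed

lemma val_power_Fin: "v x = Fin \<gamma> \<Longrightarrow> v (x ^ n) = Fin (\<Sum>_<n. \<gamma>)"
  by (induction n) (auto simp: val_mult zero_extended_def add.commute)

lemma val_power_mono: "v x \<le> v y \<Longrightarrow> v (x ^ n) \<le> v (y ^ n)"
  by (induction n) (auto intro: val_mult_mono)

lemma val_less_zero: "y \<noteq> 0 \<Longrightarrow> v y < v 0"
  by (erule val_FinE) simp

lemma val_power_le: "v y \<le> 0 \<Longrightarrow> n > 0 \<Longrightarrow> v (y ^ n) \<le> v y"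
proof (induction n)
  case (Suc n)
  then show ?case using val_mult_mono[of y y "y ^ n" 1] val_power_mono[of y 1 n] by simp
qed simp

lemma val_divide_eq_0:
  assumes "v a = v b" "b \<noteq> 0"
  shows "v (a / b) = 0"
proof -
  have "a \<noteq> 0" using assms by (metis val_eq_Pinf)
  then have "a / b \<noteq> 0" using assms by simp
  then obtain \<gamma> \<delta> where "v (a / b) = Fin \<gamma>" "v b = Fin \<delta>" using val_FinE assms(2) by metis
  moreover have "v (a / b) + v b = v b" using val_mult[of "a / b" b] assms by simp
  ultimately show ?thesis by (simp add: zero_extended_def)
qed

section \<open>Valuation ring, residue field and residue map\<close>

abbreviation VR :: "'b ring" where "VR \<equiv> valuation_ring ring_of_type_algebra v"
abbreviation VI :: "'b set" where "VI \<equiv> valuation_ideal ring_of_type_algebra v"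
abbreviation RF :: "'b set ring" where "RF \<equiv> residue_field ring_of_type_algebra v"

lemma VR_simps [simp]:
  "carrier VR = {x. 0 \<le> v x}" "x \<otimes>\<^bsub>VR\<^esub> y = x * y" "x \<oplus>\<^bsub>VR\<^esub> y = x + y"
  "\<zero>\<^bsub>VR\<^esub> = 0" "\<one>\<^bsub>VR\<^esub> = 1"
  by (simp_all add: valuation_ring_def)

lemma VI_eq: "VI = {x. 0 < v x}"
  by (simp add: valuation_ideal_def)

lemma val_ge_0_mult: "0 \<le> v x \<Longrightarrow> 0 \<le> v y \<Longrightarrow> 0 \<le> v (x * y)"
  using val_mult_mono[of 1 x 1 y] by simp

lemma val_gt_0_mult: "0 \<le> v x \<Longrightarrow> 0 < v y \<Longrightarrow> 0 < v (x * y)"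
  using val_mult_less[of 1 y x] by (cases "x = 0") (auto simp: zero_extended_def)

lemma val_gt_0_mult': "0 < v y \<Longrightarrow> 0 \<le> v x \<Longrightarrow> 0 < v (y * x)"
  using val_gt_0_mult[of x y] by (simp add: mult.commute)

lemma subring_valuation_ring:
  assumes "subring L ring_of_type_algebra"
  shows "subring {x \<in> L. 0 \<le> v x} ring_of_type_algebra"
proof -
  interpret R: ring "ring_of_type_algebra :: 'b ring" by rule
  show ?thesis
    using subringE[OF assms] by (intro R.subringI) (auto intro: val_add_ge val_ge_0_mult)
qed

lemma VR_cring: "cring VR"
proof -
  interpret R: cring "ring_of_type_algebra :: 'b ring" by rule
  have "subring {x. 0 \<le> v x} ring_of_type_algebra"
    using subring_valuation_ring[OF R.carrier_is_subring] by simp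
  then show ?thesis
    using R.subcring_iff[of "{x. 0 \<le> v x}"] R.subcringI' by (simp add: valuation_ring_def)
qed

lemma VR_a_inv: "0 \<le> v x \<Longrightarrow> \<ominus>\<^bsub>VR\<^esub> x = - x"
proof -
  assume x: "0 \<le> v x"
  interpret V: cring VR by (rule VR_cring)
  show ?thesis using V.add.inv_equality[of "- x" x] x by simp
qed

lemma VI_ideal: "ideal VI VR"
proof -
  interpret V: cring VR by (rule VR_cring)
  have "subgroup VI (add_monoid VR)"
    by (rule V.add.subgroupI)
      (auto simp: VI_eq val_add_gt VR_a_inv a_inv_def[symmetric] exI[of _ "0::'b"] less_imp_le zero_extended_def)
  then show ?thesis
    by (intro idealI V.ring_axioms)
      (auto simp: VI_eq intro: val_gt_0_mult val_gt_0_mult')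
qed

text \<open>If both factors had value 0, so would their product.\<close>

lemma VI_prime: "primeideal VI VR"
proof -
  interpret V: cring VR by (rule VR_cring)
  show ?thesis
  proof (intro primeideal.intro primeideal_axioms.intro VI_ideal VR_cring)
    show "carrier VR \<noteq> VI" by (auto simp: VI_eq set_eq_iff intro!: exI[of _ 1])
  next
    fix a b assume "a \<in> carrier VR" "b \<in> carrier VR" "a \<otimes>\<^bsub>VR\<^esub> b \<in> VI"
    then have "0 \<le> v a" "0 \<le> v b" "v a + v b \<noteq> 0"
      by (auto simp: VI_eq val_mult)
    then show "a \<in> VI \<or> b \<in> VI"
      by (auto simp: VI_eq less_le)
  qed
qed

lemma RF_domain: "domain RF"
  unfolding residue_field_def by (rule primeideal.quotient_is_domain[OF VI_prime])

definition residue where "residue x = VI +>\<^bsub>VR\<^esub> x"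

lemma residue_hom: "ring_hom_ring VR RF residue"
  using ideal.rcos_ring_hom_ring[OF VI_ideal] unfolding residue_field_def residue_def .

lemma residue_subfield_eq: "residue_subfield ring_of_type_algebra v L = residue ` {x \<in> L. 0 \<le> v x}"
  by (simp add: residue_subfield_def residue_def)

lemma residue_eq_0_iff: "0 \<le> v x \<Longrightarrow> residue x = \<zero>\<^bsub>RF\<^esub> \<longleftrightarrow> 0 < v x"
proof -
  interpret I: ideal VI VR by (rule VI_ideal)
  assume "0 \<le> v x"
  then show ?thesis
    using I.rcos_const_imp_mem[of x] I.a_rcos_const[of x]
    by (auto simp: residue_def residue_field_def FactRing_def VI_eq)
qed

lemma residue_eqI:
  assumes "0 \<le> v x" "0 < v (x - y)"
  shows "residue x = residue y"
proof -
  interpret h: ring_hom_ring VR RF residue by (rule residue_hom)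
  have y: "0 \<le> v y" using val_diff_ge[of 0 x "x - y"] assms by simp
  have "residue (x - y + y) = residue (x - y) \<oplus>\<^bsub>RF\<^esub> residue y"
    using h.hom_add[of "x - y" y] assms y by simp
  also have "residue (x - y) = \<zero>\<^bsub>RF\<^esub>" using residue_eq_0_iff assms by simp
  finally show ?thesis using y by simp
qed

lemma VR_eval: "set ks \<subseteq> carrier VR \<Longrightarrow> 0 \<le> v g \<Longrightarrow> ring.eval VR ks g = poly (Poly (rev ks)) g"
proof -
  interpret V: cring VR by (rule VR_cring)
  have pow: "0 \<le> v g \<Longrightarrow> g [^]\<^bsub>VR\<^esub> n = g ^ n" for n :: nat
    by (induction n) (auto simp: mult.commute)
  show "set ks \<subseteq> carrier VR \<Longrightarrow> 0 \<le> v g \<Longrightarrow> ?thesis"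
    by (induction ks) (auto simp: Poly_append poly_monom mult.commute add.commute pow)
qed

text \<open>An algebraic equation for the residue of \<open>g\<close> is lifted coefficientwise to
  the valuation ring of \<open>L\<close>. The leading residue is nonzero, so its lift has value 0;
  the vanishing of the residue equation becomes a positive value at \<open>g\<close>.\<close>

lemma residue_algebraicD:
  assumes L: "subring L ring_of_type_algebra" and g: "0 \<le> v g"
    and alg: "(ring.algebraic RF over residue_subfield ring_of_type_algebra v L) (residue g)"
  obtains P where "range (coeff P) \<subseteq> L" "v (lead_coeff P) = 0" "0 < v (poly P g)"
proof -
  interpret D: domain RF by (rule RF_domain)
  interpret h: ring_hom_ring VR RF residue by (rule residue_hom)
  let ?L = "{x \<in> L. 0 \<le> v x}"
  note L' = subringE[OF subring_valuation_ring[OF L]]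
  have "subring ?L VR"
    using L' by (intro h.R.subringI) (simp_all add: VR_a_inv subset_iff)
  then have sub: "subring (residue ` ?L) RF" by (rule h.img_is_subring)
  obtain p where p: "p \<in> carrier ((residue ` ?L)[X]\<^bsub>RF\<^esub>)" "p \<noteq> []" "D.eval p (residue g) = \<zero>\<^bsub>RF\<^esub>"
    using D.algebraicE[OF sub _ alg[unfolded residue_subfield_eq]] h.hom_closed g by auto
  from p have sp: "set p \<subseteq> residue ` ?L" and hd: "hd p \<noteq> \<zero>\<^bsub>RF\<^esub>"
    by (auto simp: univ_poly_def polynomial_def)
  from sp have "p \<in> map residue ` lists ?L" unfolding lists_image[symmetric] by blast
  then obtain ks where ks: "p = map residue ks" "set ks \<subseteq> ?L" by auto
  then have ne: "ks \<noteq> []" using p by auto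
  have ksV: "set ks \<subseteq> carrier VR" using ks by auto
  have "residue (h.R.eval ks g) = D.eval p (residue g)"
    using h.eval_hom'[of g ks] ks(1) ksV g by simp
  then have "residue (poly (Poly (rev ks)) g) = \<zero>\<^bsub>RF\<^esub>"
    using p(3) VR_eval[OF ksV g] by simp
  moreover have "0 \<le> v (poly (Poly (rev ks)) g)"
    using h.R.eval_in_carrier[OF ksV, of g] VR_eval[OF ksV g] g by simp
  ultimately have pos: "0 < v (poly (Poly (rev ks)) g)" using residue_eq_0_iff by simp
  have k: "hd ks \<in> L" "0 \<le> v (hd ks)" using ks(2) hd_in_set[OF ne] by auto
  have "residue (hd ks) \<noteq> \<zero>\<^bsub>RF\<^esub>" using hd ks(1) ne by (simp add: hd_map)
  then have hd0: "v (hd ks) = 0" using k residue_eq_0_iff[of "hd ks"] by (simp add: less_le)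
  then have "hd ks \<noteq> 0" by (auto simp: zero_extended_def)
  then have lead: "lead_coeff (Poly (rev ks)) = hd ks" by (rule lead_coeff_Poly_rev[OF ne])
  have "insert 0 (set ks) \<subseteq> L" using L'(2) ks(2) by auto
  with range_coeff_Poly_rev have "range (coeff (Poly (rev ks))) \<subseteq> L" by (rule order_trans)
  then show ?thesis by (rule that) (simp_all only: lead hd0 pos)
qed

text \<open>An approximation \<open>y\<close> of \<open>x\<close> with v(x - y) > v(x) has the same
  value as \<open>x\<close>, and also the same residue when v(x) is nonnegative.\<close>

lemma immediateI:
  assumes "F \<subseteq> L" "0 \<in> F" "\<And>x. x \<in> L \<Longrightarrow> x \<noteq> 0 \<Longrightarrow> \<exists>y\<in>F. v x < v (x - y)"
  shows "immediate ring_of_type_algebra v F L"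
proof -
  have "\<exists>y\<in>F. v y = v x \<and> (0 \<le> v x \<longrightarrow> residue x = residue y)" if x: "x \<in> L" for x
  proof (cases "x = 0")
    case False
    with assms x obtain y where "y \<in> F" "v x < v (x - y)" by blast
    then show ?thesis using val_eq_if_diff_gt residue_eqI by (metis order.strict_trans1)
  qed (use assms in auto)
  then have a: "\<exists>y\<in>F. v y = v x" and b: "0 \<le> v x \<Longrightarrow> \<exists>y\<in>F. 0 \<le> v y \<and> residue x = residue y"
    if "x \<in> L" for x using that by metis+
  have "value_group v L \<subseteq> value_group v F"
    using a unfolding value_group_def by fastforce
  moreover have "residue_subfield ring_of_type_algebra v L \<subseteq> residue_subfield ring_of_type_algebra v F"
    using b unfolding residue_subfield_eq by blast
  moreover have "value_group v F \<subseteq> value_group v L"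
    "residue_subfield ring_of_type_algebra v F \<subseteq> residue_subfield ring_of_type_algebra v L"
    using assms(1) unfolding value_group_def residue_subfield_eq by auto
  ultimately show ?thesis unfolding immediate_def by simp
qed

end

section \<open>Polynomials over algebraically closed fields\<close>

lemma const_fract_0 [simp]: "const_fract 0 = 0"
  and const_fract_1 [simp]: "const_fract 1 = 1"
  and const_fract_add: "const_fract (a + b) = const_fract a + const_fract b"
  and const_fract_diff: "const_fract (a - b) = const_fract a - const_fract b"
  and const_fract_minus: "const_fract (- a) = - const_fract a"
  and const_fract_mult: "const_fract (a * b) = const_fract a * const_fract b"
  and const_fract_eq_iff [simp]: "const_fract a = const_fract b \<longleftrightarrow> a = b"
  by (simp_all add: const_fract_def flip: to_fract_add to_fract_diff to_fract_uminus to_fract_mult one_pCons)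

lemma const_fract_eq_0_iff [simp]: "const_fract a = 0 \<longleftrightarrow> a = 0"
  using const_fract_eq_iff[of a 0] by (simp del: const_fract_eq_iff)

lemma const_fract_sum: "const_fract (sum f A) = (\<Sum>i\<in>A. const_fract (f i))"
  by (induction A rule: infinite_finite_induct) (auto simp: const_fract_add)

lemma const_fract_inverse: "const_fract (inverse a) = inverse (const_fract a)"
proof (cases "a = 0")
  case False
  then have "const_fract a * const_fract (inverse a) = 1"
    by (simp flip: const_fract_mult)
  then show ?thesis by (metis inverse_unique)
qed simp

section \<open>Evaluating polynomials over C in C(X)\<close>

text \<open>Allowing any rational function as argument lets the same factorization and approximation
  arguments serve for constants, for X and for quotients f^n/k.\<close>

definition peval :: "'a::field poly \<Rightarrow> 'a poly fract \<Rightarrow> 'a poly fract"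
  where "peval p z = poly (map_poly const_fract p) z"

lemma peval_0 [simp]: "peval 0 z = 0"
  by (simp add: peval_def)

lemma peval_pCons [simp]: "peval (pCons a p) z = const_fract a + z * peval p z"
  by (simp add: peval_def map_poly_pCons)

lemma peval_1 [simp]: "peval 1 z = 1"
  by (simp add: one_pCons)

lemma peval_diff: "peval (p - q) z = peval p z - peval q z"
proof -
  have "map_poly const_fract (p - q) = map_poly const_fract p - map_poly const_fract q"
    by (intro poly_eqI) (simp add: coeff_map_poly const_fract_diff)
  then show ?thesis by (simp add: peval_def)
qed

lemma peval_mult: "peval (p * q) z = peval p z * peval q z"
proof -
  have "map_poly const_fract (p * q) = map_poly const_fract p * map_poly const_fract q"
    by (intro poly_eqI) (simp add: coeff_map_poly coeff_mult const_fract_sum const_fract_mult)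
  then show ?thesis by (simp add: peval_def)
qed

lemma peval_power: "peval (p ^ n) z = peval p z ^ n"
  by (induction n) (auto simp: peval_mult)

lemma peval_const_fract: "peval p (const_fract c) = const_fract (poly p c)"
  by (induction p) (auto simp: const_fract_add const_fract_mult)

lemma peval_X_fract: "peval p X_fract = to_fract p"
proof (induction p)
  case (pCons a p)
  have "pCons a p = [:a:] + [:0, 1:] * p" by simp
  then have "to_fract (pCons a p) = const_fract a + X_fract * to_fract p"
    unfolding const_fract_def X_fract_def by (simp flip: to_fract_add to_fract_mult)
  with pCons show ?case by simp
qed simp

lemma X_fract_neq_const: "X_fract \<noteq> const_fract c"
  by (simp add: X_fract_def const_fract_def)

section \<open>Algebraic elements and splitting of polynomials\<close>

lemma relative_alg_closureI:
  fixes K :: "'a::field set"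
  assumes "P \<noteq> 0" "range (coeff P) \<subseteq> K" "poly P c = 0"
  shows "c \<in> relative_alg_closure K"
proof -
  interpret R: field "ring_of_type_algebra :: 'a ring" by rule
  let ?p = "rev (coeffs P)"
  have "?p \<in> carrier (K[X]\<^bsub>ring_of_type_algebra\<^esub>)"
    using assms by (auto simp: univ_poly_def polynomial_def hd_rev last_coeffs_eq_coeff_degree coeffs_def)
  moreover have "?p \<noteq> []" using assms by simp
  moreover have "R.eval ?p c = \<zero>\<^bsub>ring_of_type_algebra\<^esub>"
    using assms by (simp add: type_algebra_eval)
  ultimately have "(R.algebraic over K) c" by (rule R.algebraicI)
  then show ?thesis by (simp add: relative_alg_closure_def)
qed

lemma subfield_type_algebraD:
  assumes "subfield F (ring_of_type_algebra :: 'a::field ring)"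
  shows "0 \<in> F" "1 \<in> F" "a \<in> F \<Longrightarrow> b \<in> F \<Longrightarrow> a + b \<in> F" "a \<in> F \<Longrightarrow> b \<in> F \<Longrightarrow> a * b \<in> F"
    "a \<in> F \<Longrightarrow> inverse a \<in> F"
proof -
  interpret R: field "ring_of_type_algebra :: 'a ring" by rule
  note D = subringE[OF subfieldE(1)[OF assms]]
  show 0: "0 \<in> F" "1 \<in> F" "a \<in> F \<Longrightarrow> b \<in> F \<Longrightarrow> a + b \<in> F" "a \<in> F \<Longrightarrow> b \<in> F \<Longrightarrow> a * b \<in> F"
    using D by simp_all
  show "inverse a \<in> F" if "a \<in> F"
  proof (cases "a = 0")
    case False
    then have "inv\<^bsub>ring_of_type_algebra\<^esub> a \<in> F"
      using R.subfield_m_inv(1)[OF assms] that by simp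
    moreover have "inv\<^bsub>ring_of_type_algebra\<^esub> a = inverse a"
      using R.comm_inv_char[of a "inverse a"] False by simp
    ultimately show ?thesis by simp
  qed (use 0 in simp)
qed

text \<open>Over a field the equation can be divided by its leading coefficient.\<close>

lemma algebraic_over_field_poly:
  fixes F :: "'a::field set"
  assumes F: "subfield F ring_of_type_algebra"
    and c: "(ring.algebraic (ring_of_type_algebra :: 'a ring) over F) c"
  obtains P where "lead_coeff P = 1" "range (coeff P) \<subseteq> F" "poly P c = 0"
proof -
  interpret R: field "ring_of_type_algebra :: 'a ring" by rule
  interpret F: subfield F "ring_of_type_algebra :: 'a ring" by (rule F)
  obtain p where p: "p \<in> carrier (F[X]\<^bsub>ring_of_type_algebra\<^esub>)" "p \<noteq> []"
    "R.eval p c = \<zero>\<^bsub>ring_of_type_algebra\<^esub>"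
    using R.algebraicE[OF subfieldE(1)[OF F] _ c] by auto
  let ?P = "Poly (rev p)"
  have sp: "set p \<subseteq> F" and hd: "hd p \<noteq> 0"
    using p by (auto simp: univ_poly_def polynomial_def)
  have 0: "0 \<in> F" using subringE(2)[OF subfieldE(1)[OF F]] by simp
  have lc: "lead_coeff ?P \<noteq> 0" using lead_coeff_Poly_rev[OF p(2) hd] hd by simp
  have "insert 0 (set p) \<subseteq> F" using sp 0 by simp
  with range_coeff_Poly_rev have "range (coeff ?P) \<subseteq> F" by (rule order_trans)
  then have "coeff ?P i \<in> F" for i by (rule subsetD) (rule rangeI)
  moreover from this have "inverse (lead_coeff ?P) \<in> F"
    by (rule subfield_type_algebraD(5)[OF F])
  ultimately have "range (coeff (smult (inverse (lead_coeff ?P)) ?P)) \<subseteq> F"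
    using subringE(6)[OF subfieldE(1)[OF F]] by auto
  moreover have "lead_coeff (smult (inverse (lead_coeff ?P)) ?P) = 1"
    using lc by (simp only: lead_coeff_smult left_inverse not_False_eq_True)
  moreover have "poly (smult (inverse (lead_coeff ?P)) ?P) c = 0" using p(3) by (simp add: type_algebra_eval)
  ultimately show ?thesis using that by metis
qed

lemma algebraically_closed_root:
  assumes "algebraically_closed (ring_of_type_algebra :: 'a::field ring)"
    and p: "Polynomial.degree (p :: 'a poly) > 0"
  shows "\<exists>x. poly p x = 0"
proof -
  interpret algebraically_closed "ring_of_type_algebra :: 'a ring" by fact
  let ?P = "rev (coeffs p)"
  have nz: "p \<noteq> 0" using p by auto
  have P: "?P \<in> carrier (poly_ring ring_of_type_algebra)"
    using nz by (auto simp: univ_poly_def polynomial_def hd_rev last_coeffs_eq_coeff_degree)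
  then have "splitted ?P" by (rule roots_over_carrier)
  moreover have "Polynomials.degree ?P = Polynomial.degree p"
    by (simp add: degree_eq_length_coeffs)
  ultimately have "roots ?P \<noteq> {#}"
    using p unfolding splitted_def by auto
  then obtain x where "x \<in># roots ?P" by blast
  then have "eval ?P x = 0" using roots_mem_iff_is_root[OF P] by (auto simp: is_root_def)
  then show ?thesis using type_algebra_eval[of ?P x] by auto
qed

lemma poly_split_induct [case_names closed const linear]:
  fixes p :: "'a::field poly"
  assumes "\<And>q :: 'a poly. Polynomial.degree q > 0 \<Longrightarrow> \<exists>x. poly q x = 0"
    and "\<And>a. P [:a:]" "\<And>t q. P q \<Longrightarrow> P ([:- t, 1:] * q)"
  shows "P p"
proof (induction "Polynomial.degree p" arbitrary: p rule: less_induct)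
  case less
  show ?case
  proof (cases "Polynomial.degree p = 0")
    case True
    then show ?thesis using assms(2) by (metis degree_eq_zeroE)
  next
    case False
    then obtain t where "poly p t = 0" using assms(1) by blast
    then obtain q where q: "p = [:- t, 1:] * q" using poly_eq_0_iff_dvd by (metis dvdE)
    then have "q \<noteq> 0" using False by auto
    then have "Polynomial.degree q < Polynomial.degree p"
      using q by (simp add: degree_mult_eq del: mult_pCons_left)
    then show ?thesis using less assms(3) q by blast
  qed
qed

section \<open>Polynomials and rational functions over a subfield\<close>

lemma subfield_sum:
  assumes "subfield F (ring_of_type_algebra :: 'a::field ring)"
  shows "(\<And>i. i \<in> A \<Longrightarrow> f i \<in> F) \<Longrightarrow> sum f A \<in> F"
  by (induction A rule: infinite_finite_induct) (auto simp: subfield_type_algebraD[OF assms])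

lemma subfield_coeff_mult:
  assumes "subfield F (ring_of_type_algebra :: 'a::field ring)"
    "range (coeff p) \<subseteq> F" "range (coeff q) \<subseteq> F"
  shows "range (coeff (p * q)) \<subseteq> F"
proof (rule image_subsetI)
  fix n
  have "coeff p i \<in> F" "coeff q i \<in> F" for i using assms(2,3) by (simp_all add: image_subset_iff)
  then show "coeff (p * q) n \<in> F"
    unfolding coeff_mult by (intro subfield_sum[OF assms(1)] subfield_type_algebraD(4)[OF assms(1)])
qed

lemma subfield_coeff_const:
  assumes "subfield F (ring_of_type_algebra :: 'a::field ring)" "a \<in> F"
  shows "range (coeff [:a:]) \<subseteq> F"
  using assms(2) subfield_type_algebraD(1)[OF assms(1)] by (auto simp: coeff_pCons split: nat.splits)

lemma subfield_coeff_power: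
  assumes "subfield F (ring_of_type_algebra :: 'a::field ring)" "range (coeff p) \<subseteq> F"
  shows "range (coeff (p ^ n)) \<subseteq> F"
proof (induction n)
  case 0
  then show ?case using subfield_coeff_const[OF assms(1) subfield_type_algebraD(2)[OF assms(1)]]
    by (simp add: one_pCons)
next
  case (Suc n)
  then show ?case using subfield_coeff_mult[OF assms] by simp
qed

lemma Fract_eq_divide: "Fract p q = to_fract p / to_fract q"
  by (cases "q = 0") (simp_all add: to_fract_def fract_collapse)

lemma ratfuns_divideI:
  "q \<noteq> 0 \<Longrightarrow> range (coeff p) \<subseteq> F \<Longrightarrow> range (coeff q) \<subseteq> F \<Longrightarrow> to_fract p / to_fract q \<in> ratfuns F"
  unfolding ratfuns_def Fract_eq_divide by blast

lemma ratfuns_divideE: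
  assumes "x \<in> ratfuns F"
  obtains p q where "x = to_fract p / to_fract q" "q \<noteq> 0" "range (coeff p) \<subseteq> F" "range (coeff q) \<subseteq> F"
  using assms unfolding ratfuns_def Fract_eq_divide by blast

lemma ratfuns_mono: "F \<subseteq> L \<Longrightarrow> ratfuns F \<subseteq> ratfuns L"
  unfolding ratfuns_def by blast

lemma subring_const_fract:
  fixes F :: "'a::field set"
  assumes "subfield F ring_of_type_algebra"
  shows "subring (const_fract ` F) ring_of_type_algebra"
proof -
  have "ring_hom_ring (ring_of_type_algebra :: 'a ring) ring_of_type_algebra const_fract"
    by (intro ring_hom_ringI ring_from_type_algebra)
      (simp_all add: const_fract_add const_fract_mult)
  then show ?thesis
    using ring_hom_ring.img_is_subring subfieldE(1)[OF assms] by blast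
qed

text \<open>The lifted residue equation has constants of C(X) as coefficients; pulled back to C it
  splits into linear factors.\<close>

lemma map_poly_const_fractE:
  assumes "range (coeff Q) \<subseteq> const_fract ` F"
  obtains P where "Q = map_poly const_fract P" "Polynomial.degree Q = Polynomial.degree P"
proof -
  have inj: "inj (const_fract :: 'a \<Rightarrow> _)" by (simp add: inj_def)
  define P where "P = map_poly (inv_into UNIV const_fract) Q"
  have inv0: "inv_into UNIV const_fract 0 = (0::'a)" using inv_f_f[OF inj, of 0] by simp
  have "Q = map_poly const_fract P"
  proof (intro poly_eqI)
    fix n
    have "coeff Q n \<in> range const_fract" using assms by blast
    from f_inv_into_f[OF this] show "coeff Q n = coeff (map_poly const_fract P) n"
      using inv0 by (simp add: P_def coeff_map_poly)
  qed
  moreover have "Polynomial.degree (map_poly const_fract P) = Polynomial.degree P"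
    by (rule degree_map_poly) simp
  ultimately show ?thesis using that by metis
qed

text \<open>Without a last element, \<open>i\<close> has strict upper bounds, so \<open>suc\<close>
  is a genuine successor.\<close>

lemma limit_order_suc:
  assumes "limit_order r" "i \<in> Field r"
  shows "(i, wo_rel.suc r {i}) \<in> r - Id"
proof -
  interpret wo_rel r using assms by (simp add: limit_order_def wo_rel_def)
  obtain j where "(i, j) \<in> r - Id" using assms by (auto simp: limit_order_def)
  then have "AboveS {i} \<noteq> {}" by (auto simp: AboveS_def Field_def)
  then show ?thesis using suc_greater[of "{i}" i] assms by auto
qed

section \<open>Algebraic closures of dense subfields\<close>

locale dense_algebraic = field_valuation v
  for v :: "'a::field poly fract \<Rightarrow> 'g::linordered_ab_group_add extended" +
  fixes K Kc :: "'a set"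
  assumes subfield_K: "subfield K ring_of_type_algebra"
    and subfield_Kc: "subfield Kc ring_of_type_algebra"
    and K_subset: "K \<subseteq> Kc"
    and dense: "dense_in ring_of_type_algebra (v \<circ> const_fract) K Kc"
    and closed: "algebraic_closure (ring_of_type_algebra :: 'a ring) Kc"
    and val_alg: "valuation_algebraic ring_of_type_algebra v (const_fract ` Kc) (ratfuns Kc)"
begin

lemmas Kc_closed = subfield_type_algebraD[OF subfield_Kc]

lemma root_exists: "Polynomial.degree (q :: 'a poly) > 0 \<Longrightarrow> \<exists>x. poly q x = 0"
proof (rule algebraically_closed_root)
  interpret algebraic_closure "ring_of_type_algebra :: 'a ring" Kc by (rule closed)
  show "algebraically_closed (ring_of_type_algebra :: 'a ring)" by unfold_locales
qed

lemma split_induct [case_names const linear]: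
  assumes "\<And>a. P [:a:]" "\<And>t q. P q \<Longrightarrow> P ([:- t, 1:] * q)"
  shows "P (p :: 'a poly)"
  using root_exists assms by (rule poly_split_induct)

lemma annihilating_poly:
  obtains P where "lead_coeff P = 1" "range (coeff P) \<subseteq> Kc" "poly P c = 0"
proof -
  interpret algebraic_closure "ring_of_type_algebra :: 'a ring" Kc by (rule closed)
  have "(ring.algebraic (ring_of_type_algebra :: 'a ring) over Kc) c"
    by (rule algebraic_extension) simp
  from algebraic_over_field_poly[OF subfield_Kc this] show ?thesis using that by blast
qed

lemma val_peval_le_peval:
  assumes "\<And>t. v (z - const_fract t) \<le> v (w - const_fract t)"
  shows "v (peval p z) \<le> v (peval p w)"
proof (induction p rule: split_induct)
  case (linear t q)
  have "peval [:- t, 1:] z = z - const_fract t" "peval [:- t, 1:] w = w - const_fract t"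
    by (simp_all add: const_fract_minus)
  then show ?case unfolding peval_mult using linear assms by (metis val_mult_mono)
qed simp

text \<open>This is continuity of roots read contrapositively: a value at \<open>z\<close> above the
  bound forces a root closer to \<open>z\<close> than \<open>v y\<close>. Each linear factor
  contributes at most \<open>v y\<close>.\<close>

lemma val_peval_le_degree:
  "(\<And>t. poly p t = 0 \<Longrightarrow> v (z - const_fract t) \<le> v y) \<Longrightarrow>
     v (peval p z) \<le> v (const_fract (lead_coeff p) * y ^ Polynomial.degree p)"
proof (induction p rule: split_induct)
  case (linear t q)
  have z: "peval [:- t, 1:] z = z - const_fract t"
    by (simp add: const_fract_minus)
  show ?case
  proof (cases "q = 0")
    case False
    have "v (peval q z) \<le> v (const_fract (lead_coeff q) * y ^ Polynomial.degree q)"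
      using linear by (simp add: poly_mult)
    moreover have "v (z - const_fract t) \<le> v y"
      using linear.prems by (simp add: poly_mult)
    ultimately have "v (peval ([:- t, 1:] * q) z) \<le>
        v (y * (const_fract (lead_coeff q) * y ^ Polynomial.degree q))"
      unfolding peval_mult z by (intro val_mult_mono)
    moreover have "Polynomial.degree ([:- t, 1:] * q) = Suc (Polynomial.degree q)"
      using False by (simp add: degree_mult_eq del: mult_pCons_left)
    moreover have "lead_coeff ([:- t, 1:] * q) = lead_coeff q"
      by (simp add: lead_coeff_mult del: mult_pCons_left)
    ultimately show ?thesis by (simp only: power_Suc mult_ac)
  qed simp
qed simp

text \<open>Boundedness below by values from \<open>Kc\<close> defines a valuation ring containing \<open>C\<close>, \<open>Kc(X)\<close> and
  all \<open>1/(X - c)\<close>; this is what allows approximation by \<open>K\<close> to the precision \<open>v(X - c)\<close>.\<close>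

definition bounded_below :: "'a poly fract \<Rightarrow> bool"
  where "bounded_below y \<longleftrightarrow> (\<exists>k\<in>Kc. k \<noteq> 0 \<and> v (const_fract k) \<le> v y)"

lemma bounded_below_nonneg: "0 \<le> v y \<Longrightarrow> bounded_below y"
  unfolding bounded_below_def using Kc_closed(2) by (intro bexI[of _ 1]) auto

lemma bounded_below_add: "bounded_below x \<Longrightarrow> bounded_below y \<Longrightarrow> bounded_below (x + y)"
  unfolding bounded_below_def
proof (elim bexE conjE)
  fix k l
  assume "k \<in> Kc" "k \<noteq> 0" "v (const_fract k) \<le> v x" "l \<in> Kc" "l \<noteq> 0" "v (const_fract l) \<le> v y"
  moreover have "v (const_fract k) \<le> v (const_fract l) \<or> v (const_fract l) \<le> v (const_fract k)"
    by (rule linear)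
  ultimately show "\<exists>k\<in>Kc. k \<noteq> 0 \<and> v (const_fract k) \<le> v (x + y)"
    by (meson order_trans val_add_ge)
qed

lemma bounded_below_sum: "(\<And>i. i \<in> A \<Longrightarrow> bounded_below (f i)) \<Longrightarrow> bounded_below (sum f A)"
  by (induction A rule: infinite_finite_induct) (auto simp: bounded_below_nonneg bounded_below_add)

lemma bounded_below_minus: "bounded_below x \<Longrightarrow> bounded_below (- x)"
  by (simp add: bounded_below_def)

lemma bounded_below_mult: "bounded_below x \<Longrightarrow> bounded_below y \<Longrightarrow> bounded_below (x * y)"
  unfolding bounded_below_def
proof (elim bexE conjE)
  fix k l
  assume "k \<in> Kc" "k \<noteq> 0" "v (const_fract k) \<le> v x" "l \<in> Kc" "l \<noteq> 0" "v (const_fract l) \<le> v y"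
  then show "\<exists>k\<in>Kc. k \<noteq> 0 \<and> v (const_fract k) \<le> v (x * y)"
    using Kc_closed(4) by (intro bexI[of _ "k * l"]) (auto simp: const_fract_mult val_mult_mono)
qed

lemma bounded_below_power: "bounded_below x \<Longrightarrow> bounded_below (x ^ n)"
  by (induction n) (auto intro: bounded_below_mult bounded_below_nonneg)

text \<open>Multiples of a value are values of powers, which puts the torsion condition into
  multiplicative form.\<close>

lemma torsion:
  assumes "y \<in> ratfuns Kc" "y \<noteq> 0"
  obtains n k where "n > 0" "k \<in> Kc" "k \<noteq> 0" "v (y ^ n) = v (const_fract k)"
proof -
  obtain \<gamma> where g: "v y = Fin \<gamma>" using assms val_FinE by blast
  then have "\<gamma> \<in> value_group v (ratfuns Kc)" using assms by (auto simp: value_group_def)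
  then obtain n where "n > 0" "(\<Sum>_<(n::nat). \<gamma>) \<in> value_group v (const_fract ` Kc)"
    using val_alg unfolding valuation_algebraic_def by blast
  then obtain k where k: "k \<in> Kc" "v (const_fract k) = v (y ^ n)"
    using val_power_Fin[OF g, of n] unfolding value_group_def by auto
  then have "k \<noteq> 0" using assms by (metis val_eq_Pinf const_fract_0 power_not_zero)
  then show ?thesis using that \<open>n > 0\<close> k by metis
qed

text \<open>For negative \<open>v y\<close> a positive power has value at most \<open>v y\<close>,
  so the constant matching \<open>y ^ n\<close> is a lower bound.\<close>

lemma bounded_below_ratfuns: "y \<in> ratfuns Kc \<Longrightarrow> bounded_below y"
proof (cases "0 \<le> v y")
  case False
  assume y: "y \<in> ratfuns Kc"
  have "y \<noteq> 0" using False by auto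
  from torsion[OF y this] obtain n k where "n > 0" "k \<in> Kc" "k \<noteq> 0" "v (y ^ n) = v (const_fract k)" .
  then show ?thesis using val_power_le[of y n] False unfolding bounded_below_def
    by (metis linear)
qed (rule bounded_below_nonneg)

text \<open>If \<open>c\<close> has negative value, dividing a monic equation for it by
  \<open>c ^ m\<close> expresses \<open>c\<close> as a polynomial in 1/c over \<open>Kc\<close>, and
  1/c has nonnegative value.\<close>

lemma bounded_below_const: "bounded_below (const_fract c)"
proof (cases "0 \<le> v (const_fract c)")
  case False
  obtain P where P: "lead_coeff P = 1" "range (coeff P) \<subseteq> Kc" "poly P c = 0"
    by (rule annihilating_poly)
  have "Polynomial.degree P \<noteq> 0"
  proof
    assume "Polynomial.degree P = 0"
    then obtain a where "P = [:a:]" by (rule degree_eq_zeroE)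
    with P show False by simp
  qed
  then obtain m where m: "Polynomial.degree P = Suc m" using not0_implies_Suc by blast
  have c: "c \<noteq> 0" using False by auto
  have "0 = poly P c / c ^ m" using P by simp
  also have "\<dots> = (\<Sum>i\<le>m. coeff P i * c ^ i / c ^ m) + c"
    using P(1) c by (simp add: poly_altdef m sum_divide_distrib add_divide_distrib)
  also have "(\<Sum>i\<le>m. coeff P i * c ^ i / c ^ m) = (\<Sum>i\<le>m. coeff P i * inverse c ^ (m - i))"
    using c by (intro sum.cong) (auto simp: power_diff field_simps)
  finally have "const_fract c = - (\<Sum>i\<le>m. const_fract (coeff P i) * const_fract (inverse c ^ (m - i)))"
    by (simp add: eq_neg_iff_add_eq_0 add.commute flip: const_fract_mult const_fract_sum const_fract_minus)
  also have "bounded_below \<dots>"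
  proof (intro bounded_below_minus bounded_below_sum bounded_below_mult)
    fix i
    have "coeff P i \<in> Kc" using P by auto
    then show "bounded_below (const_fract (coeff P i))"
      using bounded_below_nonneg[of 0] by (cases "coeff P i = 0") (auto simp: bounded_below_def)
    have "v 1 \<le> v (inverse (const_fract c))"
      using val_inverse_mono[of "const_fract c" 1] False c by simp
    then have "v 1 \<le> v (const_fract (inverse c) ^ (m - i))"
      using val_power_mono[of 1 "const_fract (inverse c)" "m - i"] by (simp add: const_fract_inverse)
    moreover have "const_fract (inverse c) ^ j = const_fract (inverse c ^ j)" for j
      by (induction j) (auto simp: const_fract_mult)
    ultimately show "bounded_below (const_fract (inverse c ^ (m - i)))"
      by (intro bounded_below_nonneg) simp
  qed
  finally show ?thesis .
qed (rule bounded_below_nonneg)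

lemma bounded_below_peval: "bounded_below z \<Longrightarrow> bounded_below (peval p z)"
  by (induction p)
    (auto simp: bounded_below_nonneg bounded_below_const bounded_below_add bounded_below_mult)

lemma bounded_below_X: "bounded_below X_fract"
proof (rule bounded_below_ratfuns)
  have "to_fract [:0, 1:] / to_fract 1 \<in> ratfuns Kc"
    using Kc_closed by (intro ratfuns_divideI) (auto simp: coeff_pCons split: nat.splits)
  then show "X_fract \<in> ratfuns Kc" by (simp add: X_fract_def)
qed

lemma inverse_to_fract_ratfuns:
  assumes "p \<noteq> 0" "range (coeff p) \<subseteq> Kc"
  shows "inverse (to_fract p) \<in> ratfuns Kc"
  using ratfuns_divideI[OF assms(1) subfield_coeff_const[OF subfield_Kc Kc_closed(2)] assms(2)]
  by (simp add: divide_inverse one_pCons[symmetric])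

text \<open>If P annihilates \<open>c\<close> and q = P/(X - c), then 1/(X - c) = q/P, where 1/P
  lies in Kc(X).\<close>

lemma bounded_below_inverse_linear: "bounded_below (inverse (X_fract - const_fract c))"
proof -
  obtain P where P: "lead_coeff P = 1" "range (coeff P) \<subseteq> Kc" "poly P c = 0"
    by (rule annihilating_poly)
  then obtain q where q: "P = [:- c, 1:] * q" using poly_eq_0_iff_dvd by (metis dvdE)
  have "P \<noteq> 0" using P by auto
  have eq: "to_fract P = (X_fract - const_fract c) * peval q X_fract"
    unfolding peval_X_fract[symmetric] q peval_mult by (simp add: const_fract_minus)
  moreover have "to_fract P \<noteq> 0" using \<open>P \<noteq> 0\<close> by simp
  ultimately have "inverse (X_fract - const_fract c) = peval q X_fract * inverse (to_fract P)"
    unfolding eq by auto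
  then show ?thesis
    using bounded_below_ratfuns[OF inverse_to_fract_ratfuns[OF \<open>P \<noteq> 0\<close> P(2)]]
      bounded_below_mult bounded_below_peval[OF bounded_below_X] by simp
qed

section \<open>Approximation by \<open>K\<close> and by its algebraic closure\<close>

text \<open>Density provides precisions from the value group of \<open>Kc\<close>; a lower bound
  \<open>k\<close> of 1/y yields such a precision, v(1/k), that is at least \<open>v y\<close>.
  Leaving elements of \<open>K\<close> unchanged will preserve the coefficients 0 and 1 of a
  polynomial, hence its degree if it is monic.\<close>

lemma approx_const:
  assumes "a \<in> Kc" "y \<noteq> 0" "bounded_below (inverse y)"
  shows "\<exists>b\<in>K. (a \<in> K \<longrightarrow> b = a) \<and> v y < v (const_fract a - const_fract b)"
proof (cases "a \<in> K")
  case True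
  then show ?thesis using val_less_zero[OF assms(2)] by (intro bexI[of _ a]) auto
next
  case False
  from assms(3) obtain k where k: "k \<in> Kc" "k \<noteq> 0" "v (const_fract k) \<le> v (inverse y)"
    unfolding bounded_below_def by blast
  have y: "v y \<le> v (const_fract (inverse k))"
    using val_inverse_mono[of "const_fract k" "inverse y"] k assms by (simp add: const_fract_inverse)
  have "const_fract (inverse k) \<noteq> 0" using k by simp
  then obtain \<gamma> where g: "v (const_fract (inverse k)) = Fin \<gamma>" by (rule val_FinE)
  then have "\<gamma> \<in> value_group (v \<circ> const_fract) Kc"
    using k Kc_closed(5) by (auto simp: value_group_def)
  then obtain b where "b \<in> K" "Fin \<gamma> < v (const_fract (a - b))"
    using dense assms(1) unfolding dense_in_def by auto
  moreover from y g this(2) have "v y < v (const_fract a - const_fract b)"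
    by (metis const_fract_diff order.strict_trans1)
  ultimately show ?thesis using False by blast
qed

lemma approx_poly:
  assumes "range (coeff p) \<subseteq> Kc" "bounded_below z" "y \<noteq> 0" "bounded_below (inverse y)"
  shows "\<exists>q. (\<forall>i. coeff q i \<in> K \<and> (coeff p i \<in> K \<longrightarrow> coeff q i = coeff p i)) \<and>
    v y < v (peval p z - peval q z)"
  using assms
proof (induction p arbitrary: y)
  case 0
  have "0 \<in> K" by (rule subfield_type_algebraD(1)[OF subfield_K])
  then show ?case using val_less_zero[OF 0(3)] by (intro exI[of _ 0]) auto
next
  case (pCons a p)
  have a: "a \<in> Kc" and p: "range (coeff p) \<subseteq> Kc"
    using pCons.prems(1) by (auto simp: coeff_pCons image_subset_iff split: nat.splits)
  obtain b where b: "b \<in> K" "a \<in> K \<longrightarrow> b = a" "v y < v (const_fract a - const_fract b)"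
    using approx_const[OF a pCons.prems(3,4)] by blast
  \<comment> \<open>By Horner's scheme the tail is multiplied by \<open>z\<close> and needs
    precision \<open>y / z\<close>. For \<open>z = 0\<close> the product vanishes and
    \<open>y\<close> is a placeholder.\<close>
  define y' where "y' = (if z = 0 then y else y / z)"
  have "y' \<noteq> 0" using pCons.prems by (auto simp: y'_def)
  moreover have "bounded_below (inverse y')"
    using bounded_below_mult[OF pCons.prems(2,4)] pCons.prems(4)
    by (auto simp: y'_def field_simps)
  ultimately obtain q where q: "\<forall>i. coeff q i \<in> K \<and> (coeff p i \<in> K \<longrightarrow> coeff q i = coeff p i)"
    "v y' < v (peval p z - peval q z)"
    using pCons.IH[OF p pCons.prems(2)] by blast
  have "v y < v (z * (peval p z - peval q z))"
  proof (cases "z = 0")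
    case True
    then show ?thesis using val_less_zero[OF pCons.prems(3)] by simp
  next
    case False
    then show ?thesis using val_mult_less[OF q(2) False] by (simp add: y'_def)
  qed
  from val_add_gt[OF b(3) this] have "v y < v (peval (pCons a p) z - peval (pCons b q) z)"
    by (simp add: algebra_simps)
  moreover have "\<forall>i. coeff (pCons b q) i \<in> K \<and>
      (coeff (pCons a p) i \<in> K \<longrightarrow> coeff (pCons b q) i = coeff (pCons a p) i)"
    using b q by (auto simp: coeff_pCons split: nat.splits)
  ultimately show ?case by blast
qed

text \<open>A monic P over \<open>Kc\<close> with root \<open>c\<close> is replaced by a monic q
  over \<open>K\<close> of the same degree n with v(q(c)) > v(y^n). By continuity of roots, some
  root of q is closer to \<open>c\<close> than \<open>v y\<close>.\<close>

lemma alg_closure_dense: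
  assumes "y \<noteq> 0" "bounded_below (inverse y)"
  obtains d where "d \<in> relative_alg_closure K" "v y < v (const_fract c - const_fract d)"
proof -
  obtain P where P: "lead_coeff P = 1" "range (coeff P) \<subseteq> Kc" "poly P c = 0"
    by (rule annihilating_poly)
  define n where "n = Polynomial.degree P"
  have "bounded_below (inverse (y ^ n))"
    using bounded_below_power[OF assms(2), of n] by (simp add: power_inverse)
  then obtain q where q: "\<And>i. coeff q i \<in> K" "\<And>i. coeff P i \<in> K \<Longrightarrow> coeff q i = coeff P i"
    "v (y ^ n) < v (peval P (const_fract c) - peval q (const_fract c))"
    using approx_poly[OF P(2) bounded_below_const, of "y ^ n"] assms(1) by (metis power_not_zero)
  note K = subfield_type_algebraD[OF subfield_K]
  \<comment> \<open>Since 0 and 1 lie in \<open>K\<close>, the approximation leaves them unchanged,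
    so q stays monic of degree n.\<close>
  have "coeff q n = 1" using q(2)[of n] P(1) K by (simp add: n_def)
  moreover have "coeff q i = 0" if "i > n" for i
    using q(2)[of i] K that by (simp add: n_def coeff_eq_0)
  ultimately have deg: "Polynomial.degree q = n" "lead_coeff q = 1"
    by (metis degree_le le_degree not_le order.antisym zero_neq_one)+
  then have "q \<noteq> 0" by auto
  have less: "v (y ^ n) < v (peval q (const_fract c))"
    using q(3) P(3) by (simp add: peval_const_fract)
  have "\<exists>d. poly q d = 0 \<and> v y < v (const_fract c - const_fract d)"
  proof (rule ccontr)
    assume "\<not> ?thesis"
    then have "v (peval q (const_fract c)) \<le> v (const_fract (lead_coeff q) * y ^ Polynomial.degree q)"
      by (intro val_peval_le_degree) (auto simp: not_less)
    with less deg show False by simp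
  qed
  then obtain d where "poly q d = 0" "v y < v (const_fract c - const_fract d)" by blast
  moreover have "d \<in> relative_alg_closure K"
    using relative_alg_closureI[OF \<open>q \<noteq> 0\<close> _ calculation(1)] q(1) by auto
  ultimately show ?thesis using that by blast
qed

section \<open>Approximation of the variable\<close>

lemma exists_better_approx: "\<exists>d. v (X_fract - const_fract c) < v (X_fract - const_fract d)"
proof (rule ccontr)
  assume "\<not> ?thesis"
  then have best: "v (X_fract - const_fract t) \<le> v (X_fract - const_fract c)" for t
    by (auto simp: not_less)
  \<comment> \<open>c - t is the difference of X - t and X - c, neither of which has value below v(X
    - t).\<close>
  have "v (X_fract - const_fract t) \<le> v (const_fract c - const_fract t)" for t
    using val_diff_ge[OF order_refl best, of t] by simp
  then have spec: "v (peval Q X_fract) \<le> v (const_fract (poly Q c))" for Q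
    unfolding peval_const_fract[symmetric] by (rule val_peval_le_peval)
  obtain P where P: "lead_coeff P = 1" "range (coeff P) \<subseteq> Kc" "poly P c = 0"
    by (rule annihilating_poly)
  define y where "y = to_fract P"
  have "P \<noteq> 0" using P by auto
  then have y: "y \<noteq> 0" by (simp add: y_def)
  note one = subfield_coeff_const[OF subfield_Kc Kc_closed(2)]
  have "y \<in> ratfuns Kc"
    using ratfuns_divideI[OF _ P(2) one] by (simp add: y_def one_pCons[symmetric])
  from torsion[OF this y] obtain n k
    where n: "n > 0" and k: "k \<in> Kc" "k \<noteq> 0" "v (y ^ n) = v (const_fract k)" .
  have yn: "y ^ n = peval (P ^ n) X_fract"
    unfolding y_def peval_power by (simp only: peval_X_fract)
  define g where "g = y ^ n / const_fract k"
  have vg: "v g = 0" unfolding g_def using k by (intro val_divide_eq_0) simp_all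
  have "g \<in> ratfuns Kc"
    unfolding g_def yn peval_X_fract unfolding const_fract_def
    using k by (intro ratfuns_divideI subfield_coeff_power subfield_coeff_const P subfield_Kc) simp_all
  then have "residue g \<in> residue_subfield ring_of_type_algebra v (ratfuns Kc)"
    using vg by (simp add: residue_subfield_eq)
  then have "(ring.algebraic RF over residue_subfield ring_of_type_algebra v (const_fract ` Kc)) (residue g)"
    using val_alg unfolding valuation_algebraic_def by blast
  from residue_algebraicD[OF subring_const_fract[OF subfield_Kc] eq_refl[OF vg[symmetric]] this] obtain Q'
    where Q': "range (coeff Q') \<subseteq> const_fract ` Kc" "v (lead_coeff Q') = 0" "0 < v (poly Q' g)" .
  from map_poly_const_fractE[OF Q'(1)] obtain Q
    where Q: "Q' = map_poly const_fract Q" "Polynomial.degree Q' = Polynomial.degree Q" .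
  \<comment> \<open>The lifted equation splits over C. Its leading coefficient has value 0, so its
    positive value at \<open>g\<close> must come from a root t with v(g - t) > 0.\<close>
  have "\<exists>t. 0 < v (g - const_fract t)"
  proof (rule ccontr)
    assume "\<not> ?thesis"
    then have "v (peval Q g) \<le> v (const_fract (lead_coeff Q) * 1 ^ Polynomial.degree Q)"
      by (intro val_peval_le_degree) (simp add: not_less)
    also have "\<dots> = 0" using Q'(2) Q by (simp add: coeff_map_poly)
    finally show False using Q'(3) Q(1) by (simp add: peval_def)
  qed
  then obtain t where "v 1 < v (g - const_fract t)" by auto
  then have "v (const_fract k * 1) < v (const_fract k * (g - const_fract t))"
    using k by (intro val_mult_less) simp_all
  also have "const_fract k * (g - const_fract t) = y ^ n - const_fract (t * k)"
    using k by (simp add: g_def const_fract_mult algebra_simps)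
  finally have less: "v (y ^ n) < v (y ^ n - const_fract (t * k))" using k by simp
  \<comment> \<open>At \<open>c\<close> the polynomial P^n - tk equals -tk, because P(c) = 0 and n >
    0.\<close>
  have "v (y ^ n - const_fract (t * k)) \<le> v (const_fract (t * k))"
    using spec[of "P ^ n - [:t * k:]"] n P(3)
    by (simp add: peval_diff yn const_fract_minus zero_power)
  with less have "v (y ^ n) < v (const_fract (t * k))" by (rule order.strict_trans2)
  from val_diff_eq_left[OF this] less show False by simp
qed

text \<open>A better approximation \<open>e\<close> in C can be moved to an element algebraic over
  \<open>K\<close> within precision v(X - c), which is reachable because 1/(X - c) is bounded
  below.\<close>

lemma exists_better_algebraic_approx:
  obtains d where "d \<in> relative_alg_closure K" "v (X_fract - const_fract c) < v (X_fract - const_fract d)"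
proof -
  obtain e where e: "v (X_fract - const_fract c) < v (X_fract - const_fract e)"
    using exists_better_approx by blast
  have "X_fract - const_fract c \<noteq> 0" using X_fract_neq_const[of c] by simp
  from alg_closure_dense[OF this bounded_below_inverse_linear, of e] obtain d
    where d: "d \<in> relative_alg_closure K" "v (X_fract - const_fract c) < v (const_fract e - const_fract d)" .
  from val_add_gt[OF e d(2)] show ?thesis using that d(1) by simp
qed

section \<open>Approximating sequences and the induced valuation\<close>

text \<open>Each attained value indexes one approximation realizing it. An arbitrary well-order
  \<open>W\<close> need not agree with the order of values, so only the records are kept: attained
  values greater than all attained values that precede them in \<open>W\<close>.\<close>

lemma cofinal_approx_exists: "\<exists>r a. cofinal_approx v K r a"
proof -
  define G where "G = {\<gamma>. \<exists>c\<in>relative_alg_closure K. v (X_fract - const_fract c) = Fin \<gamma>}"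
  have fin: "\<exists>\<gamma>. v (X_fract - const_fract c) = Fin \<gamma>" for c
    using X_fract_neq_const[of c] val_FinE[of "X_fract - const_fract c"] by auto
  obtain a where a: "\<And>\<gamma>. \<gamma> \<in> G \<Longrightarrow> a \<gamma> \<in> relative_alg_closure K \<and> v (X_fract - const_fract (a \<gamma>)) = Fin \<gamma>"
    using bchoice[of G "\<lambda>\<gamma> c. c \<in> relative_alg_closure K \<and> v (X_fract - const_fract c) = Fin \<gamma>"]
    unfolding G_def by blast
  have better: "\<exists>\<delta>\<in>G. Fin \<delta> > v (X_fract - const_fract c)" for c
    by (rule exists_better_algebraic_approx[of c]) (metis (mono_tags, lifting) G_def fin mem_Collect_eq)
  obtain W :: "'g rel" where W: "well_order_on UNIV W" using well_order_on by blast
  define S where "S = {\<gamma>\<in>G. \<forall>\<delta>\<in>G. (\<delta>, \<gamma>) \<in> W - Id \<longrightarrow> \<delta> < \<gamma>}"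
  define r where "r = Restr W S"
  have WO: "Well_order W" and FW: "Field W = UNIV"
    using W well_order_on_Field by (auto simp: well_order_on_Well_order)
  interpret W: wo_rel W using WO by (simp add: wo_rel_def)
  have cof: "\<exists>\<delta>\<in>S. \<gamma> \<le> \<delta>" if "\<gamma> \<in> G" for \<gamma>
  proof -
    \<comment> \<open>The \<open>W\<close>-first attained value that is at least
      \<open>\<gamma>\<close> is a record: a preceding value not below it would also be at least
      \<open>\<gamma>\<close>.\<close>
    define M where "M = {\<delta>\<in>G. \<gamma> \<le> \<delta>}"
    define m where "m = W.minim M"
    have "M \<noteq> {}" using that by (auto simp: M_def)
    then have m: "m \<in> M" "\<And>x. x \<in> M \<Longrightarrow> (m, x) \<in> W"
      using W.minim_in[of M] W.minim_least[of M] by (auto simp: m_def FW)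
    have "\<delta> < m" if "\<delta> \<in> G" "(\<delta>, m) \<in> W - Id" for \<delta>
    proof (rule ccontr)
      assume "\<not> \<delta> < m"
      then have "\<delta> \<in> M" using m(1) that by (auto simp: M_def)
      then have "(m, \<delta>) \<in> W" by (rule m(2))
      then show False using that W.ANTISYM by (auto dest: antisymD)
    qed
    then have "m \<in> S" "\<gamma> \<le> m" using m(1) by (auto simp: S_def M_def)
    then show ?thesis by blast
  qed
  have F: "Field r = S"
    unfolding r_def using W.REFL FW by (simp add: Refl_Field_Restr)
  have S: "S \<subseteq> G" by (auto simp: S_def)
  have r_less: "i < j" if "(i, j) \<in> r - Id" for i j
    using that by (auto simp: r_def S_def)
  have "\<exists>j. (i, j) \<in> r - Id" if "i \<in> S" for i
  proof -
    have "v (X_fract - const_fract (a i)) = Fin i" using a that S by blast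
    then obtain d where "d \<in> G" "i < d" using better[of "a i"] by auto
    then obtain j where "j \<in> S" "i < j" using cof by (meson order.strict_trans2)
    \<comment> \<open>If \<open>j\<close> preceded \<open>i\<close>, the record property of
      \<open>i\<close> would give \<open>j < i\<close>.\<close>
    moreover have "(i, j) \<in> W"
    proof (rule ccontr)
      assume "(i, j) \<notin> W"
      then have "(j, i) \<in> W - Id" using W.TOTALS FW by auto
      then show False using \<open>i \<in> S\<close> \<open>j \<in> S\<close> \<open>i < j\<close> by (auto simp: S_def)
    qed
    ultimately show ?thesis using that by (auto simp: r_def)
  qed
  moreover have "S \<noteq> {}"
    \<comment> \<open>The constant 0 is an arbitrary choice that shows some value to be
      attained.\<close>
    using better[of 0] cof by auto
  moreover have "Well_order r" unfolding r_def by (rule Well_order_Restr[OF WO])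
  ultimately have "limit_order r" by (simp add: limit_order_def F)
  moreover have "\<exists>i\<in>S. v (X_fract - const_fract c) \<le> v (X_fract - const_fract (a i))" for c
  proof -
    obtain \<delta> where "\<delta> \<in> G" "v (X_fract - const_fract c) < Fin \<delta>" using better by blast
    moreover from this obtain i where "i \<in> S" "\<delta> \<le> i" using cof by blast
    moreover from this have "v (X_fract - const_fract (a i)) = Fin i" using a S by auto
    ultimately show ?thesis by (intro bexI[of _ i]) (auto intro: order_trans less_imp_le)
  qed
  moreover have "v (X_fract - const_fract (a i)) < v (X_fract - const_fract (a j))"
    if "(i, j) \<in> r - Id" for i j
  proof -
    have "i \<in> S" "j \<in> S" using that F by (auto simp: Field_def)
    then show ?thesis using a r_less[OF that] S by (metis less_extended_simps(1) subset_iff)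
  qed
  ultimately have "cofinal_approx v K r a"
    unfolding cofinal_approx_def F using a S by auto
  then show ?thesis by blast
qed

text \<open>Cofinality is applied to an algebraic element already strictly closer to X than
  \<open>c\<close>.\<close>

lemma cofinal_approx_strict:
  assumes "cofinal_approx v K r a"
  obtains i where "i \<in> Field r" "v (X_fract - const_fract c) < v (X_fract - const_fract (a i))"
  using exists_better_algebraic_approx[of c] assms unfolding cofinal_approx_def
  by (metis order.strict_trans2)

lemma cofinal_approx_diff:
  assumes "cofinal_approx v K r a" "(i, j) \<in> r - Id"
  shows "v (const_fract (a i) - const_fract (a j)) = v (X_fract - const_fract (a i))"
proof -
  have "v (X_fract - const_fract (a i)) < v (X_fract - const_fract (a j))"
    using assms unfolding cofinal_approx_def by blast
  from val_diff_eq_left[OF this] show ?thesis by (simp add: val_minus_commute)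
qed

text \<open>The differences of a_i and later terms have value v(X - a_i), which increases with i;
  the successor of i gives the limit condition.\<close>

lemma extends_with_limit_self:
  assumes a: "cofinal_approx v K r a"
  shows "extends_with_limit v r a v"
proof -
  have lim: "limit_order r"
    and mono: "\<And>i j. (i, j) \<in> r - Id \<Longrightarrow> v (X_fract - const_fract (a i)) < v (X_fract - const_fract (a j))"
    using a unfolding cofinal_approx_def by blast+
  have "pseudo_cauchy ratfun_field v r (const_fract \<circ> a)"
    unfolding pseudo_cauchy_def using lim mono cofinal_approx_diff[OF a] by simp
  then show ?thesis
    unfolding extends_with_limit_def pseudo_limit_def
    using cofinal_approx_diff[OF a] limit_order_suc[OF lim] valued by simp
qed

text \<open>A limit \<open>b\<close> would satisfy v(b - a_i) = v(X - a_i), hence v(X - b) \<ge> v(X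
  - a_i) for all i, although some a_i is strictly closer to X than \<open>b\<close>.\<close>

lemma no_algebraic_limit:
  assumes a: "cofinal_approx v K r a"
  shows "\<not> pseudo_limit ratfun_field v r (const_fract \<circ> a) (const_fract b)"
proof
  assume b: "pseudo_limit ratfun_field v r (const_fract \<circ> a) (const_fract b)"
  obtain i where i: "i \<in> Field r" "v (X_fract - const_fract b) < v (X_fract - const_fract (a i))"
    using cofinal_approx_strict[OF a] .
  have "limit_order r" using a by (simp add: cofinal_approx_def)
  then have "v (const_fract b - const_fract (a i)) = v (X_fract - const_fract (a i))"
    using b i(1) cofinal_approx_diff[OF a limit_order_suc] by (simp add: pseudo_limit_def)
  then have "v (X_fract - const_fract (a i)) \<le> v (X_fract - const_fract b)"
    using val_diff_ge[OF order_refl, of "X_fract - const_fract (a i)" "const_fract b - const_fract (a i)"]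
    by simp
  with i(2) show False by simp
qed

lemma extends_with_limit_unique:
  assumes a: "cofinal_approx v K r a" and w: "extends_with_limit v r a w"
  shows "w = v"
proof
  interpret w: field_valuation w
    using w by (intro field_valuation.intro) (simp add: extends_with_limit_def)
  have const: "w (const_fract c) = v (const_fract c)" for c
    using w by (simp add: extends_with_limit_def)
  have X_minus: "w (X_fract - const_fract c) = v (X_fract - const_fract c)" for c
  proof -
    obtain i where i: "i \<in> Field r" "v (X_fract - const_fract c) < v (X_fract - const_fract (a i))"
      using cofinal_approx_strict[OF a] .
    \<comment> \<open>c - a_i is, up to sign, the difference of X - c and X - a_i, so it has the
      smaller value v(X - c). As \<open>w\<close> agrees with \<open>v\<close> on constants and on X
      - a_i, the same comparison in \<open>w\<close> yields w(X - c).\<close>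
    have v: "v (const_fract (c - a i)) = v (X_fract - const_fract c)"
      using val_diff_eq_left[OF i(2)] by (simp add: const_fract_diff val_minus_commute)
    have "limit_order r" using a by (simp add: cofinal_approx_def)
    from cofinal_approx_diff[OF a limit_order_suc[OF this i(1)]]
    have "w (X_fract - const_fract (a i)) = v (X_fract - const_fract (a i))"
      using w i(1) const by (simp add: extends_with_limit_def pseudo_limit_def flip: const_fract_diff)
    then have "w (const_fract (c - a i)) < w (X_fract - const_fract (a i))"
      using i(2) v const by simp
    from w.val_diff_eq_left[OF this] show ?thesis
      using v const[of "c - a i"] by (simp add: const_fract_diff w.val_minus_commute)
  qed
  have poly: "w (to_fract p) = v (to_fract p)" for p
    unfolding peval_X_fract[symmetric]
  proof (induction p rule: split_induct)
    case (linear t q)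
    have "peval [:- t, 1:] X_fract = X_fract - const_fract t" by (simp add: const_fract_minus)
    with linear show ?case
      unfolding peval_mult val_mult w.val_mult by (simp only: X_minus)
  qed (simp add: const)
  fix x :: "'a poly fract"
  obtain p q where x: "x = to_fract p / to_fract q" "q \<noteq> 0"
    by (cases x) (auto simp: Fract_eq_divide)
  then have "x * to_fract q = to_fract p" by simp
  \<comment> \<open>The nonzero denominator has finite value, which can be cancelled.\<close>
  then have "w x + v (to_fract q) = v x + v (to_fract q)"
    using val_mult[of x "to_fract q"] w.val_mult[of x "to_fract q"] poly by metis
  moreover obtain \<gamma> where "v (to_fract q) = Fin \<gamma>" using x(2) val_FinE[of "to_fract q"] by auto
  ultimately show "w x = v x"
    using w.val_not_Minf[of x] val_not_Minf[of x] by (cases "w x"; cases "v x") auto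
qed

text \<open>No approximating sequence has a limit in C, so the second branch applies, with
  \<open>v\<close> itself as the unique extension.\<close>

lemma induced: "induced_by v K Kc"
proof -
  have "\<exists>w. extends_with_limit v r a w \<and> (\<forall>w'. extends_with_limit v r a w' \<longrightarrow> w' = w) \<and>
      equivalent_on (ratfuns Kc) v w" if "cofinal_approx v K r a" for r a
    using extends_with_limit_self[OF that] extends_with_limit_unique[OF that]
    by (intro exI[of _ v]) (auto simp: equivalent_on_def)
  then show ?thesis
    unfolding induced_by_def using cofinal_approx_exists no_algebraic_limit by simp
qed

section \<open>Immediate extensions and descent to K(X)\<close>

text \<open>The precision v(p) is available because 1/p lies in Kc(X) and is therefore bounded
  below.\<close>

lemma approx_numerator:
  assumes "range (coeff p) \<subseteq> Kc" "p \<noteq> 0"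
  obtains q where "range (coeff q) \<subseteq> K" "v (to_fract p) < v (to_fract p - to_fract q)"
proof -
  obtain q where "\<forall>i. coeff q i \<in> K" "v (to_fract p) < v (peval p X_fract - peval q X_fract)"
    using approx_poly[OF assms(1) bounded_below_X, of "to_fract p"] assms
      bounded_below_ratfuns[OF inverse_to_fract_ratfuns] by auto
  then show ?thesis using that by (auto simp: peval_X_fract)
qed

lemma immediate_ratfuns: "immediate ratfun_field v (ratfuns K) (ratfuns Kc)"
proof (rule immediateI)
  note K = subfield_type_algebraD[OF subfield_K]
  show "ratfuns K \<subseteq> ratfuns Kc" by (rule ratfuns_mono[OF K_subset])
  show "0 \<in> ratfuns K"
    using ratfuns_divideI[of "[:1:]" "[:0:]" K] subfield_coeff_const[OF subfield_K] K by simp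
  fix x assume xin: "x \<in> ratfuns Kc" and nz: "x \<noteq> 0"
  from xin obtain p q where x: "x = to_fract p / to_fract q" and q: "q \<noteq> 0"
    and c: "range (coeff p) \<subseteq> Kc" "range (coeff q) \<subseteq> Kc" by (rule ratfuns_divideE)
  have p: "p \<noteq> 0" using nz x by auto
  obtain p' where p': "range (coeff p') \<subseteq> K" "v (to_fract p) < v (to_fract p - to_fract p')"
    using approx_numerator[OF c(1) p] .
  obtain q' where q': "range (coeff q') \<subseteq> K" "v (to_fract q) < v (to_fract q - to_fract q')"
    using approx_numerator[OF c(2) q] .
  have vq: "v (to_fract q') = v (to_fract q)" and vp: "v (to_fract p') = v (to_fract p)"
    using val_eq_if_diff_gt p'(2) q'(2) by blast+
  have "to_fract q' \<noteq> 0" using vq q by (metis val_eq_Pinf to_fract_eq_0_iff)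
  then have q0: "q' \<noteq> 0" by auto
  \<comment> \<open>The error p/q - p'/q' equals (q'(p - p') - p'(q - q'))/(q q'). Both terms of the
    numerator have value above v(q' p), while x = q' p/(q q').\<close>
  have "v (to_fract q' * to_fract p) < v (to_fract q' * (to_fract p - to_fract p'))"
    by (rule val_mult_less) fact+
  moreover have "v (to_fract q' * to_fract p) < v (to_fract p' * (to_fract q - to_fract q'))"
  proof -
    have "to_fract p' \<noteq> 0" using vp p by (metis val_eq_Pinf to_fract_eq_0_iff)
    \<comment> \<open>Equality of the values of p and p', and of q and q', gives v(p' q) = v(q'
      p).\<close>
    from val_mult_less[OF q'(2) this] show ?thesis by (simp add: val_mult vp vq add.commute)
  qed
  ultimately have "v (to_fract q' * to_fract p) <
      v (to_fract q' * (to_fract p - to_fract p') - to_fract p' * (to_fract q - to_fract q'))"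
    by (rule val_diff_gt)
  then have "v (inverse (to_fract q * to_fract q') * (to_fract q' * to_fract p)) <
      v (inverse (to_fract q * to_fract q') *
        (to_fract q' * (to_fract p - to_fract p') - to_fract p' * (to_fract q - to_fract q')))"
    by (rule val_mult_less) (simp add: q q0)
  also have "inverse (to_fract q * to_fract q') * (to_fract q' * to_fract p) = x"
    using q q0 by (simp add: x field_simps)
  also have "inverse (to_fract q * to_fract q') *
        (to_fract q' * (to_fract p - to_fract p') - to_fract p' * (to_fract q - to_fract q')) =
      x - to_fract p' / to_fract q'"
    using q q0 by (simp add: x field_simps)
  finally show "\<exists>y\<in>ratfuns K. v x < v (x - y)"
    using ratfuns_divideI[OF q0 p'(1) q'(1)] by blast
qed

text \<open>A nonzero constant serves as its own precision, since its inverse is again a constant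
  and thus bounded below.\<close>

lemma immediate_constants: "immediate ratfun_field v (const_fract ` K) (const_fract ` Kc)"
proof (rule immediateI)
  show "const_fract ` K \<subseteq> const_fract ` Kc" using K_subset by blast
  show "0 \<in> const_fract ` K"
    using subfield_type_algebraD(1)[OF subfield_K] by (auto simp: image_iff intro!: bexI[of _ 0])
  fix x assume "x \<in> const_fract ` Kc" and nz: "x \<noteq> 0"
  then obtain c where c: "c \<in> Kc" "x = const_fract c" by blast
  then have "bounded_below (inverse x)" by (metis bounded_below_const const_fract_inverse)
  from approx_const[OF c(1) nz this] c(2) show "\<exists>y\<in>const_fract ` K. v x < v (x - y)" by blast
qed

text \<open>Both Kc|K and Kc(X)|K(X) are immediate, so value groups and residue fields are the same
  over \<open>K\<close> as over \<open>Kc\<close>.\<close>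

lemma valuation_algebraic_base: "valuation_algebraic ratfun_field v (const_fract ` K) (ratfuns K)"
proof -
  have "value_group v (ratfuns K) \<subseteq> value_group v (ratfuns Kc)"
    "residue_subfield ratfun_field v (ratfuns K) \<subseteq> residue_subfield ratfun_field v (ratfuns Kc)"
    using immediate_ratfuns by (simp_all add: immediate_def)
  then show ?thesis
    using val_alg immediate_constants unfolding valuation_algebraic_def immediate_def by auto
qed

end

theorem proposition4p4:
  fixes v :: "'a::field poly fract \<Rightarrow> 'g::linordered_ab_group_add extended"
    and K Kc :: "'a set"
  assumes "valued_field ratfun_field v"
    and "is_completion ring_of_type_algebra (v \<circ> const_fract) K Kc"
    and "algebraic_closure (ring_of_type_algebra :: 'a ring) Kc"
    and "valuation_algebraic ratfun_field v (const_fract ` Kc) (ratfuns Kc)"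
  shows "valuation_algebraic ratfun_field v (const_fract ` K) (ratfuns K) \<and>
    induced_by v K Kc \<and>
    immediate ratfun_field v (ratfuns K) (ratfuns Kc)"
proof -
  interpret dense_algebraic v K Kc
    using assms
    by (intro dense_algebraic.intro dense_algebraic_axioms.intro field_valuation.intro)
      (simp_all add: is_completion_def)
  show ?thesis
    using valuation_algebraic_base induced immediate_ratfuns by blast
qed

end
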